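(* Let $G$ be a left brace such that $\lambda_a(a)=a$ for all $a\in G$. Then $G$ is a two-sided brace, the multiplicative group of $G$ is nilpotent of class at most $2$, and $\mathrm{Soc}(G)\subseteq \mathrm{Z}(G)$, the center of (the multiplicative group of) $G$. Moreover: (i) The torsion subgroup $T(G)$ of the multiplicative group of $G$ is an ideal of $G$. If $G_e$ is the unique maximal $2$-subgroup of $T(G)$ and $G_o$ is the maximal subgroup of $T(G)$ consisting of the elements of odd order, then both $G_e$ and $G_o$ are ideals of the brace $G$ and $\mathrm{Soc}(T(G))=\mathrm{Soc}(G_e)\,\mathrm{Z}(G_o)$. (ii) Furthermore, if $G_e$ is finite and the multiplicative group of $G/T(G)$ is finitely generated, then the solution $(G,r)$ of the Yang-Baxter equation associated to the brace $G$ is a multipermutation solution.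
   Context: A left brace is a set $G$ with two operations $+$ and $\cdot$ such that $(G,+)$ is an abelian group (the additive group), $(G,\cdot)$ is a group (the multiplicative group), and $a(b+c)+a=ab+ac$ for all $a,b,c\in G$. A right brace is defined in the same way with the condition $(a+b)c+c=ac+bc$ instead. A two-sided brace is a structure that is both a left and a right brace. The neutral elements of the two groups coincide and are denoted $1$. For $a\in G$, $\lambda_a\colon G\to G$ is the bijection $\lambda_a(b)=ab-a$. It is an automorphism of $(G,+)$, and $a\mapsto\lambda_a$ is a homomorphism from $(G,\cdot)$ to $\mathrm{Sym}_G$. An ideal of a left brace $G$ is a normal subgroup $I$ of $(G,\cdot)$ such that $\lambda_a(b)\in I$ for all $a\in G$, $b\in I$. An ideal is also a subgroup of $(G,+)$, hence a left brace itself, and the quotient $G/I$ (multiplicative and additive cosets coincide) is a left brace, the quotient brace. The socle is $\mathrm{Soc}(G)=\{a\in G\mid \lambda_a=\mathrm{id}\}$; for an ideal viewed as a brace, the socle is computed in that brace. $\mathrm{Z}(H)$ denotes the center of the multiplicative group of a brace $H$. The torsion subgroup $T(G)$ is the set of elements of finite order of $(G,\cdot)$ (a subgroup, since this group is nilpotent). Let $X$ be a non-empty set and $r\colon X^2\to X^2$ a map, written $r(x,y)=(\sigma_x(y),\gamma_y(x))$. The pair $(X,r)$ is a non-degenerate involutive set-theoretic solution of the Yang-Baxter equation if: $r^2=\mathrm{id}_{X^2}$; the maps $\sigma_x$ and $\gamma_x$ are bijections for all $x\in X$; and $r_1r_2r_1=r_2r_1r_2$, where $r_1=r\times\mathrm{id}_X$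 and $r_2=\mathrm{id}_X\times r$ on $X^3$. The solution associated to a left brace $G$ is $(G,r)$ with $r(x,y)=(\lambda_x(y),\lambda_{\lambda_x(y)}^{-1}(x))$; it is a non-degenerate involutive set-theoretic solution. Retraction: define $x\sim y$ on $X$ if $\sigma_x=\sigma_y$. There is a (well-defined) induced solution $\mathrm{Ret}(X,r)=(X/\!\sim,\tilde r)$ with $\tilde r([x],[y])=([\sigma_x(y)],[\gamma_y(x)])$. Put $\mathrm{Ret}^0(X,r)=(X,r)$, $\mathrm{Ret}^1=\mathrm{Ret}$ and $\mathrm{Ret}^k(X,r)=\mathrm{Ret}(\mathrm{Ret}^{k-1}(X,r))$ for $k>1$. $(X,r)$ is a multipermutation solution if there is a nonnegative integer $m$ such that the underlying set of $\mathrm{Ret}^m(X,r)$ has cardinality $1$. *)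

theory Defs
  imports "HOL-Algebra.Generated_Groups" "HOL-Algebra.Multiplicative_Group" "HOL-Algebra.QuotRing"
begin

section \<open>Groups\<close>

definition center :: "('a, 'm) monoid_scheme \<Rightarrow> 'a set" where
  "center G = {z \<in> carrier G. \<forall>x \<in> carrier G. z \<otimes>\<^bsub>G\<^esub> x = x \<otimes>\<^bsub>G\<^esub> z}"

text \<open>The index is shifted by one against the usual numbering: index \<open>0\<close> gives the whole group,
  so that a group has class at most \<open>c\<close> iff its term of index \<open>c\<close> is trivial.\<close>

primrec lower_central :: "('a, 'm) monoid_scheme \<Rightarrow> nat \<Rightarrow> 'a set" where
  "lower_central G 0 = carrier G"
| "lower_central G (Suc n) = generate G
     (\<Union>x \<in> lower_central G n. \<Union>y \<in> carrier G. {x \<otimes>\<^bsub>G\<^esub> y \<otimes>\<^bsub>G\<^esub> inv\<^bsub>G\<^esub> x \<otimes>\<^bsub>G\<^esub> inv\<^bsub>G\<^esub> y})"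

definition nilpotent_group :: "('a, 'm) monoid_scheme \<Rightarrow> bool" where
  "nilpotent_group G \<longleftrightarrow> (\<exists>c. lower_central G c = {\<one>\<^bsub>G\<^esub>})"

definition nilpotency_class :: "('a, 'm) monoid_scheme \<Rightarrow> nat" where
  "nilpotency_class G = (LEAST c. lower_central G c = {\<one>\<^bsub>G\<^esub>})"

definition finitely_generated_group :: "('a, 'm) monoid_scheme \<Rightarrow> bool" where
  "finitely_generated_group G \<longleftrightarrow> (\<exists>S. finite S \<and> S \<subseteq> carrier G \<and> generate G S = carrier G)"

definition torsion :: "('a, 'm) monoid_scheme \<Rightarrow> 'a set" where
  "torsion G = {a \<in> carrier G. \<exists>n::nat. 0 < n \<and> a [^]\<^bsub>G\<^esub> n = \<one>\<^bsub>G\<^esub>}"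

text \<open>Elements of infinite order have \<open>ord\<close> equal to \<open>0\<close>, which is neither a power of two nor odd.\<close>

definition two_subgroup :: "('a, 'm) monoid_scheme \<Rightarrow> 'a set \<Rightarrow> bool" where
  "two_subgroup G H \<longleftrightarrow> subgroup H G \<and> (\<forall>x \<in> H. \<exists>k. group.ord G x = 2 ^ k)"

definition odd_subgroup :: "('a, 'm) monoid_scheme \<Rightarrow> 'a set \<Rightarrow> bool" where
  "odd_subgroup G H \<longleftrightarrow> subgroup H G \<and> (\<forall>x \<in> H. odd (group.ord G x))"

definition maximal_with :: "('a set \<Rightarrow> bool) \<Rightarrow> 'a set \<Rightarrow> bool" where
  "maximal_with P H \<longleftrightarrow> P H \<and> (\<forall>K. P K \<longrightarrow> H \<subseteq> K \<longrightarrow> K = H)"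


section \<open>Braces\<close>

text \<open>The record type of rings serves only as a signature with two operations. The two neutral
  elements \<open>\<one>\<close> and \<open>\<zero>\<close> are separate fields; that they coincide follows from the axioms.\<close>

locale left_brace = abelian_group G + group G for G (structure) +
  assumes left_brace_distr:
    "\<lbrakk>a \<in> carrier G; b \<in> carrier G; c \<in> carrier G\<rbrakk> \<Longrightarrow> a \<otimes> (b \<oplus> c) \<oplus> a = a \<otimes> b \<oplus> a \<otimes> c"

locale right_brace = abelian_group G + group G for G (structure) +
  assumes right_brace_distr:
    "\<lbrakk>a \<in> carrier G; b \<in> carrier G; c \<in> carrier G\<rbrakk> \<Longrightarrow> (a \<oplus> b) \<otimes> c \<oplus> c = a \<otimes> c \<oplus> b \<otimes> c"

locale two_sided_brace = left_brace G + right_brace G for G (structure)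

definition brace_lambda :: "('a, 'm) ring_scheme \<Rightarrow> 'a \<Rightarrow> 'a \<Rightarrow> 'a" where
  "brace_lambda G a b = a \<otimes>\<^bsub>G\<^esub> b \<ominus>\<^bsub>G\<^esub> a"

definition brace_ideal :: "'a set \<Rightarrow> ('a, 'm) ring_scheme \<Rightarrow> bool" where
  "brace_ideal I G \<longleftrightarrow> I \<lhd> G \<and> (\<forall>a \<in> carrier G. \<forall>b \<in> I. brace_lambda G a b \<in> I)"

text \<open>An ideal \<open>I\<close> viewed as a brace is \<open>G\<lparr>carrier := I\<rparr>\<close>.\<close>

definition socle :: "('a, 'm) ring_scheme \<Rightarrow> 'a set" where
  "socle G = {a \<in> carrier G. \<forall>b \<in> carrier G. brace_lambda G a b = b}"

text \<open>Additive and multiplicative cosets of an ideal coincide, so the elementwise sum of two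
  multiplicative cosets is again one.\<close>

definition brace_quotient :: "('a, 'm) ring_scheme \<Rightarrow> 'a set \<Rightarrow> 'a set ring" where
  "brace_quotient G I =
     \<lparr>carrier = rcosets\<^bsub>G\<^esub> I, mult = set_mult G, one = I, zero = I, add = set_add G\<rparr>"


section \<open>Set-theoretic solutions of the Yang-Baxter equation\<close>

text \<open>In a pair \<open>(X, r)\<close> only the values of \<open>r\<close> on \<open>X \<times> X\<close> are relevant.\<close>

type_synonym 'a set_map = "'a set \<times> ('a \<times> 'a \<Rightarrow> 'a \<times> 'a)"

definition ybe_sigma :: "('a \<times> 'a \<Rightarrow> 'a \<times> 'a) \<Rightarrow> 'a \<Rightarrow> 'a \<Rightarrow> 'a" where
  "ybe_sigma r x y = fst (r (x, y))"

definition ybe_gamma :: "('a \<times> 'a \<Rightarrow> 'a \<times> 'a) \<Rightarrow> 'a \<Rightarrow> 'a \<Rightarrow> 'a" where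
  "ybe_gamma r y x = snd (r (x, y))"

definition ybe_r1 :: "('a \<times> 'a \<Rightarrow> 'a \<times> 'a) \<Rightarrow> 'a \<times> 'a \<times> 'a \<Rightarrow> 'a \<times> 'a \<times> 'a" where
  "ybe_r1 r = (\<lambda>(x, y, z). (fst (r (x, y)), snd (r (x, y)), z))"

definition ybe_r2 :: "('a \<times> 'a \<Rightarrow> 'a \<times> 'a) \<Rightarrow> 'a \<times> 'a \<times> 'a \<Rightarrow> 'a \<times> 'a \<times> 'a" where
  "ybe_r2 r = (\<lambda>(x, y, z). (x, r (y, z)))"

definition ybe_solution :: "'a set_map \<Rightarrow> bool" where
  "ybe_solution = (\<lambda>(X, r).
     X \<noteq> {} \<and> r ` (X \<times> X) \<subseteq> X \<times> X \<and>
     (\<forall>p \<in> X \<times> X. r (r p) = p) \<and>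
     (\<forall>x \<in> X. bij_betw (ybe_sigma r x) X X \<and> bij_betw (ybe_gamma r x) X X) \<and>
     (\<forall>t \<in> X \<times> X \<times> X. ybe_r1 r (ybe_r2 r (ybe_r1 r t)) = ybe_r2 r (ybe_r1 r (ybe_r2 r t))))"

definition brace_solution :: "('a, 'm) ring_scheme \<Rightarrow> 'a set_map" where
  "brace_solution G = (carrier G, \<lambda>(x, y).
     (brace_lambda G x y,
      inv_into (carrier G) (brace_lambda G (brace_lambda G x y)) x))"

definition ret_rel :: "'a set_map \<Rightarrow> ('a \<times> 'a) set" where
  "ret_rel = (\<lambda>(X, r).
     {(x, y). x \<in> X \<and> y \<in> X \<and> (\<forall>z \<in> X. ybe_sigma r x z = ybe_sigma r y z)})"

text \<open>The induced map is lifted to classes \<open>A\<close>, \<open>B\<close> as a union over all representatives; for a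
  solution every member of such a union is the same class.\<close>

definition retraction :: "'a set_map \<Rightarrow> 'a set set_map" where
  "retraction = (\<lambda>(X, r).
     (X // ret_rel (X, r), \<lambda>(A, B).
       (\<Union>x \<in> A. \<Union>y \<in> B. ret_rel (X, r) `` {ybe_sigma r x y},
        \<Union>x \<in> A. \<Union>y \<in> B. ret_rel (X, r) `` {ybe_gamma r y x})))"

text \<open>Since \<^const>\<open>retraction\<close> changes the element type, it cannot be iterated as it stands. The
  iteration therefore renames each class to one chosen representative of it; by
  \<open>class_rep_inj_on\<close> below this replaces the retraction by an isomorphic copy.\<close>

definition relabel :: "('a \<Rightarrow> 'b) \<Rightarrow> 'a set_map \<Rightarrow> 'b set_map" where
  "relabel f = (\<lambda>(X, r). (f ` X, \<lambda>(u, v). map_prod f f (r (inv_into X f u, inv_into X f v))))"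

definition class_rep :: "'a set \<Rightarrow> 'a" where
  "class_rep A = (SOME x. x \<in> A)"

definition iterated_retraction :: "nat \<Rightarrow> 'a set_map \<Rightarrow> 'a set_map" where
  "iterated_retraction k = (\<lambda>S. relabel class_rep (retraction S)) ^^ k"

definition multipermutation_solution :: "'a set_map \<Rightarrow> bool" where
  "multipermutation_solution S \<longleftrightarrow>
     ybe_solution S \<and> (\<exists>m. card (fst (iterated_retraction m S)) = 1)"

lemma equiv_ret_rel: "equiv X (ret_rel (X, r))"
  by (rule equivI) (auto simp: ret_rel_def refl_on_def sym_def trans_def)

lemma class_rep_in:
  assumes "A \<in> X // ret_rel (X, r)"
  shows "class_rep A \<in> A"
  unfolding class_rep_def some_in_eq
  using in_quotient_imp_non_empty[OF equiv_ret_rel assms] .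

lemma class_rep_inj_on: "inj_on class_rep (fst (retraction (X, r)))"
proof (rule inj_onI)
  fix A B
  assume "A \<in> fst (retraction (X, r))" "B \<in> fst (retraction (X, r))" "class_rep A = class_rep B"
  then have "A \<in> X // ret_rel (X, r)" "B \<in> X // ret_rel (X, r)" "class_rep A \<in> A \<inter> B"
    using class_rep_in by (fastforce simp: retraction_def)+
  then show "A = B"
    using quotient_disj[OF equiv_ret_rel] by blast
qed

end

theory Submission
  imports Defs "HOL-Computational_Algebra.Primes"
begin

text \<open>
  Put \<open>a \<star> b = \<lambda>\<^sub>a(b) - b\<close>. The hypothesis says \<open>a \<star> a = 0\<close>, so inverses are negatives, and
  comparing \<open>(ab)\<inverse>\<close> with \<open>b\<inverse>a\<inverse>\<close> gives \<open>a \<star> b = - (b \<star> a)\<close>. Hence \<open>\<star>\<close> is distributive on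
  both sides and associative, and anticommutativity forces \<open>2(a \<star> b \<star> c) = 0\<close>. The commutator of
  \<open>a\<close> and \<open>b\<close> is \<open>2(a \<star> b)\<close>, which therefore is central. Powers are additive multiples, so the
  torsion statements reduce to the primary decomposition of the additive group. The solution becomes
  \<open>r(x, y) = (y + x \<star> y, x + x \<star> y)\<close>, and its \<open>k\<close>-th retraction lives on the quotient by the elements
  killed by all products with \<open>k\<close> factors; a product with a repeated factor vanishes and triple
  products lie in the 2-part, so the ring is nilpotent as soon as the 2-part is finite.
\<close>

section \<open>Preliminaries on abelian groups, centers and greatest sets\<close>

lemmas (in abelian_group) abelian_group_simprules
  [algebra abelian_group "zero G" "add G" "a_inv G" "a_minus G"] =
  a_closed zero_closed a_inv_closed minus_closed
  a_assoc l_zero l_neg a_comm minus_eq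
  r_zero r_neg r_neg2 r_neg1 minus_add minus_minus a_lcomm

text \<open>An equivalence, so that \<open>subst (asm)\<close> can strip a common left summand from
  an equation.\<close>

lemma (in abelian_group) a_cancel:
  "\<lbrakk>x \<in> carrier G; y \<in> carrier G; z \<in> carrier G\<rbrakk> \<Longrightarrow> x \<oplus> y = x \<oplus> z \<longleftrightarrow> y = z"
  using add.right_cancel by (simp add: a_comm[of x])

lemma (in abelian_group) a_inv_zero [simp]: "\<ominus> \<zero> = \<zero>"
  by (simp add: a_inv_def)

lemma (in group) center_subgroup: "subgroup (center G) G"
proof (rule subgroupI)
  fix z assume z: "z \<in> center G"
  have "inv z \<otimes> x = x \<otimes> inv z" if x: "x \<in> carrier G" for x
  proof -
    have "z \<in> carrier G" "x = inv z \<otimes> (x \<otimes> z)"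
      using z x inv_solve_left[of x z "x \<otimes> z"] by (auto simp: center_def)
    then show ?thesis using x by (simp add: inv_solve_right m_assoc)
  qed
  with z show "inv z \<in> center G" by (simp add: center_def)
next
  fix y z assume yz: "y \<in> center G" "z \<in> center G"
  have "y \<otimes> z \<otimes> x = x \<otimes> (y \<otimes> z)" if x: "x \<in> carrier G" for x
  proof -
    have c: "y \<in> carrier G" "z \<in> carrier G" "y \<otimes> x = x \<otimes> y" "z \<otimes> x = x \<otimes> z"
      using yz x unfolding center_def by auto
    have "y \<otimes> z \<otimes> x = y \<otimes> (x \<otimes> z)" using c x by (simp only: m_assoc)
    also have "\<dots> = x \<otimes> y \<otimes> z" using c(1,2) x by (simp only: c(3) flip: m_assoc)
    also have "\<dots> = x \<otimes> (y \<otimes> z)" using c(1,2) x by (rule_tac m_assoc)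
    finally show ?thesis .
  qed
  moreover have "y \<in> carrier G" "z \<in> carrier G" using yz by (simp_all add: center_def)
  ultimately show "y \<otimes> z \<in> center G" unfolding center_def by blast
qed (auto simp: center_def)

text \<open>A greatest set is the only maximal one, so this settles existence and uniqueness of the
  maximal 2-subgroup and odd subgroup at once.\<close>

lemma maximal_with_greatest:
  assumes "P M" "\<And>K. P K \<Longrightarrow> K \<subseteq> M"
  shows "maximal_with P H \<longleftrightarrow> H = M"
  using assms unfolding maximal_with_def by blast

section \<open>The star product of a left brace\<close>

context left_brace
begin

text \<open>This is \<open>ab - a - b\<close>, the multiplication of the radical ring attached to a
  two-sided brace. In a general left brace it is additive only in the second argument.\<close>

definition star :: "'a \<Rightarrow> 'a \<Rightarrow> 'a" (infixl "\<star>" 75) where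
  "a \<star> b = brace_lambda G a b \<ominus> b"

text \<open>The brace law for \<open>a = \<one>\<close> and \<open>b = c = \<zero>\<close> collapses
  to this equation.\<close>

lemma one_eq_zero: "\<one> = \<zero>"
proof -
  have "\<one> \<otimes> (\<zero> \<oplus> \<zero>) \<oplus> \<one> = \<one> \<otimes> \<zero> \<oplus> \<one> \<otimes> \<zero>"
    by (rule left_brace_distr) simp_all
  then show ?thesis by simp
qed

lemma lambda_closed [simp]:
  "\<lbrakk>a \<in> carrier G; b \<in> carrier G\<rbrakk> \<Longrightarrow> brace_lambda G a b \<in> carrier G"
  by (simp add: brace_lambda_def)

lemma star_closed [simp]: "\<lbrakk>a \<in> carrier G; b \<in> carrier G\<rbrakk> \<Longrightarrow> a \<star> b \<in> carrier G"
  by (simp add: star_def)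

lemma lambda_eq_star:
  "\<lbrakk>a \<in> carrier G; b \<in> carrier G\<rbrakk> \<Longrightarrow> brace_lambda G a b = b \<oplus> a \<star> b"
  using lambda_closed[of a b] unfolding star_def by algebra

lemma mult_eq_star:
  "\<lbrakk>a \<in> carrier G; b \<in> carrier G\<rbrakk> \<Longrightarrow> a \<otimes> b = a \<oplus> b \<oplus> a \<star> b"
  using m_closed[of a b] unfolding star_def brace_lambda_def by algebra

lemma star_add_right:
  assumes "a \<in> carrier G" "b \<in> carrier G" "c \<in> carrier G"
  shows "a \<star> (b \<oplus> c) = a \<star> b \<oplus> a \<star> c"
proof -
  have "a \<otimes> (b \<oplus> c) = a \<otimes> b \<oplus> a \<otimes> c \<ominus> a"
    using left_brace_distr[OF assms] assms m_closed[of a "b \<oplus> c"] m_closed[of a b] m_closed[of a c]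
    by (metis a_closed add.inv_solve_right' minus_eq add.inv_solve_right)
  then show ?thesis
    using assms m_closed[of a b] m_closed[of a c]
    unfolding star_def brace_lambda_def by (simp add: a_ac minus_eq minus_add)
qed

lemma star_zero_right [simp]: "a \<in> carrier G \<Longrightarrow> a \<star> \<zero> = \<zero>"
  using star_add_right[of a \<zero> \<zero>] by (simp add: add.r_cancel_one)

lemma star_minus_right:
  assumes "a \<in> carrier G" "b \<in> carrier G"
  shows "a \<star> (\<ominus> b) = \<ominus> (a \<star> b)"
  using star_add_right[of a "\<ominus> b" b] assms by (simp add: l_neg minus_equality)

lemma star_mult_left:
  assumes "a \<in> carrier G" "b \<in> carrier G" "c \<in> carrier G"
  shows "(a \<otimes> b) \<star> c = a \<star> (b \<star> c) \<oplus> a \<star> c \<oplus> b \<star> c"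
proof -
  have "(a \<otimes> b) \<otimes> c = a \<otimes> (b \<otimes> c)"
    using assms by (rule m_assoc)
  then have "a \<oplus> b \<oplus> a \<star> b \<oplus> c \<oplus> (a \<otimes> b) \<star> c
      = a \<oplus> (b \<oplus> c \<oplus> b \<star> c) \<oplus> (a \<star> b \<oplus> a \<star> c \<oplus> a \<star> (b \<star> c))"
    using assms mult_eq_star[of "a \<otimes> b" c] mult_eq_star[of a "b \<otimes> c"]
    by (simp add: mult_eq_star star_add_right)
  then have "(a \<oplus> b \<oplus> a \<star> b \<oplus> c) \<oplus> (a \<otimes> b) \<star> c
      = (a \<oplus> b \<oplus> a \<star> b \<oplus> c) \<oplus> (a \<star> (b \<star> c) \<oplus> a \<star> c \<oplus> b \<star> c)"
    using assms by (simp add: a_ac)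
  then show ?thesis
    using assms by (subst (asm) a_cancel) simp_all
qed

end

section \<open>The star product when the associated solution is square-free,
  \<open>r(a, a) = (a, a)\<close>\<close>

locale square_free_brace = left_brace +
  assumes lambda_self: "a \<in> carrier G \<Longrightarrow> brace_lambda G a a = a"
begin

lemma star_self [simp]: "a \<in> carrier G \<Longrightarrow> a \<star> a = \<zero>"
  by (simp add: star_def lambda_self r_neg minus_eq)

lemma inv_eq_minus:
  assumes "a \<in> carrier G"
  shows "inv a = \<ominus> a"
proof -
  have "a \<otimes> \<ominus> a = \<one>"
    using assms by (simp add: mult_eq_star star_minus_right one_eq_zero r_neg)
  then show ?thesis
    using assms by (metis a_inv_closed inv_equality inv_inv)
qed

text \<open>Negation is inversion and hence reverses products. Expanding
  \<open>-(ab) = (-b)(-a)\<close> and cancelling \<open>-(a + b)\<close> leaves the claim; the sign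
  in the first argument cannot be pulled out yet.\<close>

lemma star_swap:
  assumes "a \<in> carrier G" "b \<in> carrier G"
  shows "(\<ominus> b) \<star> a = a \<star> b"
proof -
  have "\<ominus> (a \<otimes> b) = (\<ominus> b) \<otimes> (\<ominus> a)"
    using assms by (simp flip: inv_eq_minus add: inv_mult_group)
  then have "\<ominus> (a \<oplus> b) \<oplus> \<ominus> (a \<star> b) = \<ominus> (a \<oplus> b) \<oplus> \<ominus> ((\<ominus> b) \<star> a)"
    using assms by (simp add: mult_eq_star minus_add star_minus_right a_ac)
  then have "\<ominus> (a \<star> b) = \<ominus> ((\<ominus> b) \<star> a)"
    using assms by (subst (asm) a_cancel) simp_all
  then show ?thesis
    using assms by (metis a_inv_closed minus_minus star_closed)
qed

text \<open>Three uses of \<open>star_swap\<close>, combined with the sign rule for the second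
  argument.\<close>

lemma star_anticommute:
  assumes "a \<in> carrier G" "b \<in> carrier G"
  shows "a \<star> b = \<ominus> (b \<star> a)"
proof -
  have "a \<star> b = (\<ominus> b) \<star> a" using star_swap assms by simp
  also have "\<dots> = (\<ominus> a) \<star> (\<ominus> b)" using star_swap[of "\<ominus> b" a] assms by simp
  also have "\<dots> = \<ominus> (b \<star> a)" using star_swap[of b a] assms by (simp add: star_minus_right)
  finally show ?thesis .
qed

lemma star_add_left:
  assumes "a \<in> carrier G" "b \<in> carrier G" "c \<in> carrier G"
  shows "(a \<oplus> b) \<star> c = a \<star> c \<oplus> b \<star> c"
  using assms star_anticommute[of "a \<oplus> b" c] star_anticommute[of a c] star_anticommute[of b c]
  by (simp add: star_add_right minus_add)

lemma star_zero_left [simp]: "a \<in> carrier G \<Longrightarrow> \<zero> \<star> a = \<zero>"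
  using star_anticommute[of \<zero> a] by simp

lemma star_minus_left:
  assumes "a \<in> carrier G" "b \<in> carrier G"
  shows "(\<ominus> a) \<star> b = \<ominus> (a \<star> b)"
  using star_swap[of b a] star_anticommute[of b a] assms by simp

text \<open>Compare \<open>star_mult_left\<close> with the expansion of
  \<open>(a \<oplus> b \<oplus> a \<star> b) \<star> c\<close> by additivity on the left.\<close>

lemma star_assoc:
  assumes "a \<in> carrier G" "b \<in> carrier G" "c \<in> carrier G"
  shows "a \<star> b \<star> c = a \<star> (b \<star> c)"
proof -
  have "(a \<star> c \<oplus> b \<star> c) \<oplus> a \<star> b \<star> c = (a \<star> c \<oplus> b \<star> c) \<oplus> a \<star> (b \<star> c)"
    using star_mult_left[OF assms] assms by (simp add: mult_eq_star star_add_left a_ac)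
  then show ?thesis
    using assms by (subst (asm) a_cancel) simp_all
qed

text \<open>Addition and \<open>\<star>\<close> now form a ring without unit; this makes its rules
  known to the \<open>algebra\<close> method.\<close>

lemmas star_simprules
  [algebra star_ring "zero G" "add G" "a_inv G" "a_minus G" "star"] =
  abelian_group_simprules star_closed star_add_right star_add_left star_zero_right star_zero_left
  star_minus_right star_minus_left star_assoc a_inv_zero

section \<open>Two-sidedness, nilpotency of the multiplicative group, and the socle\<close>

lemma two_sided: "two_sided_brace G"
proof unfold_locales
  fix a b c assume "a \<in> carrier G" "b \<in> carrier G" "c \<in> carrier G"
  then show "(a \<oplus> b) \<otimes> c \<oplus> c = a \<otimes> c \<oplus> b \<otimes> c"
    by (simp add: mult_eq_star star_add_left a_ac)
qed

text \<open>Moving \<open>c\<close> past the single factor \<open>a \<star> b\<close> costs one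
  sign, moving it past \<open>a\<close> and \<open>b\<close> separately costs two. So the triple
  product equals its own negative.\<close>

lemma triple_two_torsion:
  assumes "a \<in> carrier G" "b \<in> carrier G" "c \<in> carrier G"
  shows "a \<star> b \<star> c \<oplus> a \<star> b \<star> c = \<zero>"
proof -
  have "a \<star> b \<star> c = \<ominus> (c \<star> (a \<star> b))" using assms by (simp add: star_anticommute[of "a \<star> b"])
  also have "\<dots> = \<ominus> (\<ominus> (a \<star> c) \<star> b)" using assms by (simp add: star_anticommute[of c a] flip: star_assoc)
  also have "\<dots> = a \<star> (c \<star> b)" using assms by (simp add: star_minus_left star_assoc)
  also have "\<dots> = \<ominus> (a \<star> b \<star> c)"
    using assms by (simp add: star_anticommute[of c b] star_minus_right star_assoc)
  finally have "a \<star> b \<star> c = \<ominus> (a \<star> b \<star> c)" .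
  then show ?thesis using assms by (metis l_neg star_closed)
qed

lemma star_sandwich:
  assumes "a \<in> carrier G" "b \<in> carrier G"
  shows "a \<star> (b \<star> a) = \<zero>"
  using assms star_anticommute[of b a] by (simp add: star_minus_right flip: star_assoc)

text \<open>The doubled products are the commutators, as \<open>commutator_eq\<close> shows; this is
  what makes them central.\<close>

lemma double_star_annihilates:
  assumes "x \<in> carrier G" "y \<in> carrier G" "w \<in> carrier G"
  shows "(x \<star> y \<oplus> x \<star> y) \<star> w = \<zero>" "w \<star> (x \<star> y \<oplus> x \<star> y) = \<zero>"
proof -
  show "(x \<star> y \<oplus> x \<star> y) \<star> w = \<zero>"
    using assms by (simp add: star_add_left triple_two_torsion)
  then show "w \<star> (x \<star> y \<oplus> x \<star> y) = \<zero>"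
    using assms star_anticommute[of w "x \<star> y \<oplus> x \<star> y"] by simp
qed

text \<open>Additively, \<open>xy\<close> and \<open>yx\<close> differ by
  \<open>x \<star> y - y \<star> x\<close>, which is twice \<open>x \<star> y\<close>. As that
  element annihilates everything, adding it is the same as multiplying by it.\<close>

lemma mult_swap:
  assumes "x \<in> carrier G" "y \<in> carrier G"
  shows "x \<otimes> y = (x \<star> y \<oplus> x \<star> y) \<otimes> (y \<otimes> x)"
proof -
  have "(x \<star> y \<oplus> x \<star> y) \<otimes> (y \<otimes> x) = x \<star> y \<oplus> x \<star> y \<oplus> y \<otimes> x"
    using assms by (simp add: mult_eq_star[of "x \<star> y \<oplus> x \<star> y"] double_star_annihilates)
  also have "\<dots> = x \<star> y \<oplus> x \<star> y \<oplus> (y \<oplus> x \<oplus> \<ominus> (x \<star> y))"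
    using assms star_anticommute[of y x] by (simp add: mult_eq_star)
  also have "\<dots> = x \<oplus> y \<oplus> x \<star> y"
    using assms star_closed[of x y] by algebra
  finally show ?thesis using assms by (simp add: mult_eq_star)
qed

lemma commutator_eq:
  assumes "x \<in> carrier G" "y \<in> carrier G"
  shows "x \<otimes> y \<otimes> inv x \<otimes> inv y = x \<star> y \<oplus> x \<star> y"
  using assms by (subst mult_swap) (simp_all add: m_assoc)

lemma commute_iff:
  assumes "x \<in> carrier G" "y \<in> carrier G"
  shows "x \<otimes> y = y \<otimes> x \<longleftrightarrow> x \<star> y \<oplus> x \<star> y = \<zero>"
  using assms mult_swap[OF assms] by (simp add: one_eq_zero)

lemma commutator_central:
  assumes "x \<in> carrier G" "y \<in> carrier G"
  shows "x \<otimes> y \<otimes> inv x \<otimes> inv y \<in> center G"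
  using assms by (simp add: commutator_eq center_def commute_iff double_star_annihilates)

text \<open>In the shifted numbering the term of index 1 is the commutator subgroup. It is central,
  so the generators of the next term are trivial and the class is at most 2.\<close>

lemma lower_central_2: "lower_central G 2 = {\<one>}"
proof -
  have "lower_central G 1 \<subseteq> center G"
    unfolding One_nat_def lower_central.simps
    by (rule generate_subgroup_incl[OF _ center_subgroup]) (use commutator_central in auto)
  then have "x \<otimes> y \<otimes> inv x \<otimes> inv y = \<one>"
    if "x \<in> lower_central G 1" "y \<in> carrier G" for x y
    using that unfolding center_def by (auto simp: m_assoc)
  then have "(\<Union>x \<in> lower_central G 1. \<Union>y \<in> carrier G. {x \<otimes> y \<otimes> inv x \<otimes> inv y}) \<subseteq> {\<one>}"
    by auto
  then have "lower_central G (Suc 1) \<subseteq> {\<one>}"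
    unfolding lower_central.simps using generate_subgroup_incl triv_subgroup by blast
  moreover have "\<one> \<in> lower_central G (Suc 1)" by (simp add: generate.one)
  ultimately show ?thesis unfolding numeral_2_eq_2 One_nat_def by blast
qed

lemma nilpotent: "nilpotent_group G" "nilpotency_class G \<le> 2"
  unfolding nilpotent_group_def nilpotency_class_def
  using lower_central_2 by (blast, blast intro: Least_le)

lemma socle_eq: "socle G = {a \<in> carrier G. \<forall>b \<in> carrier G. a \<star> b = \<zero>}"
  by (auto simp: socle_def lambda_eq_star)

lemma socle_subset_center: "socle G \<subseteq> center G"
  by (auto simp: socle_eq center_def commute_iff)

section \<open>Powers as additive multiples, and ideals\<close>

lemma add_pow_closed [simp]: "a \<in> carrier G \<Longrightarrow> [(n::nat)] \<cdot> a \<in> carrier G"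
  by (rule add.nat_pow_closed)

lemma star_add_pow_left:
  assumes "a \<in> carrier G" "b \<in> carrier G"
  shows "([(n::nat)] \<cdot> a) \<star> b = [n] \<cdot> (a \<star> b)"
  using assms by (induction n) (simp_all add: star_add_left)

lemma star_add_pow_right:
  assumes "a \<in> carrier G" "b \<in> carrier G"
  shows "a \<star> ([(n::nat)] \<cdot> b) = [n] \<cdot> (a \<star> b)"
  using assms by (induction n) (simp_all add: star_add_right)

text \<open>In the induction step the correction term is a multiple of \<open>a \<star> a\<close>,
  hence zero.\<close>

lemma pow_eq_add_pow:
  assumes "a \<in> carrier G"
  shows "a [^] (n::nat) = [n] \<cdot> a"
  using assms by (induction n) (simp_all add: one_eq_zero mult_eq_star star_add_pow_left)

text \<open>These are the two-sided ideals of the ring: absorption on the other side follows from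
  anticommutativity.\<close>

definition star_ideal :: "'a set \<Rightarrow> bool" where
  "star_ideal I \<longleftrightarrow> subgroup I (add_monoid G) \<and> (\<forall>a \<in> carrier G. \<forall>b \<in> I. a \<star> b \<in> I)"

lemma star_idealD:
  assumes "star_ideal I"
  shows "I \<subseteq> carrier G" "\<zero> \<in> I"
    and "\<And>a b. \<lbrakk>a \<in> I; b \<in> I\<rbrakk> \<Longrightarrow> a \<oplus> b \<in> I"
    and "\<And>a. a \<in> I \<Longrightarrow> \<ominus> a \<in> I"
    and "\<And>a b. \<lbrakk>a \<in> carrier G; b \<in> I\<rbrakk> \<Longrightarrow> a \<star> b \<in> I"
    and "\<And>a b. \<lbrakk>a \<in> I; b \<in> carrier G\<rbrakk> \<Longrightarrow> a \<star> b \<in> I"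
proof -
  interpret I: subgroup I "add_monoid G" using assms by (simp add: star_ideal_def)
  show sub: "I \<subseteq> carrier G" "\<zero> \<in> I" using I.subset I.one_closed by simp_all
  show "\<And>a b. \<lbrakk>a \<in> I; b \<in> I\<rbrakk> \<Longrightarrow> a \<oplus> b \<in> I" using I.m_closed by simp
  show m: "\<And>a. a \<in> I \<Longrightarrow> \<ominus> a \<in> I" using I.m_inv_closed by (simp add: a_inv_def)
  show r: "\<And>a b. \<lbrakk>a \<in> carrier G; b \<in> I\<rbrakk> \<Longrightarrow> a \<star> b \<in> I"
    using assms by (simp add: star_ideal_def)
  show "\<And>a b. \<lbrakk>a \<in> I; b \<in> carrier G\<rbrakk> \<Longrightarrow> a \<star> b \<in> I"
    using m r sub by (metis star_anticommute subsetD)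
qed

lemma star_ideal_subgroup:
  assumes "star_ideal I"
  shows "subgroup I G"
proof (rule subgroupI)
  show "I \<subseteq> carrier G" "I \<noteq> {}" using star_idealD[OF assms] by auto
  show "inv a \<in> I" if "a \<in> I" for a
    using star_idealD[OF assms] that by (metis inv_eq_minus subsetD)
  show "a \<otimes> b \<in> I" if "a \<in> I" "b \<in> I" for a b
    using star_idealD[OF assms] that by (simp add: mult_eq_star subset_iff)
qed

text \<open>Normality holds because conjugating \<open>h\<close> by \<open>x\<close> multiplies it
  by the commutator, twice \<open>x \<star> h\<close>, which the ideal absorbs.\<close>

lemma star_ideal_brace_ideal:
  assumes "star_ideal I"
  shows "brace_ideal I G"
  unfolding brace_ideal_def normal_inv_iff
proof (intro conjI ballI)
  show "subgroup I G" using star_ideal_subgroup[OF assms] .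
  show "brace_lambda G a b \<in> I" if "a \<in> carrier G" "b \<in> I" for a b
    using star_idealD[OF assms] that by (simp add: lambda_eq_star subset_iff)
  fix x h assume xh: "x \<in> carrier G" "h \<in> I"
  then have h: "h \<in> carrier G" using star_idealD[OF assms] by blast
  have "x \<otimes> h \<otimes> inv x = (x \<star> h \<oplus> x \<star> h) \<otimes> h"
    using xh h by (subst mult_swap) (simp_all add: m_assoc)
  also have "\<dots> \<in> I"
    using star_idealD[OF assms] xh subgroup.m_closed[OF star_ideal_subgroup[OF assms]] by simp
  finally show "x \<otimes> h \<otimes> inv x \<in> I" .
qed

text \<open>The additive inverse inside \<open>brace_lambda\<close> is taken relative to the
  carrier; on an additive subgroup it agrees with the one of \<open>G\<close>.\<close>

lemma socle_star_ideal:
  assumes "star_ideal I"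
  shows "socle (G\<lparr>carrier := I\<rparr>) = {a \<in> I. \<forall>b \<in> I. a \<star> b = \<zero>}"
proof -
  have "brace_lambda (G\<lparr>carrier := I\<rparr>) a b = brace_lambda G a b" if "a \<in> I" "b \<in> I" for a b
  proof -
    have "subgroup I (add_monoid G)" using assms by (simp add: star_ideal_def)
    from add.m_inv_consistent[OF this] that show ?thesis
      by (simp add: brace_lambda_def a_minus_def a_inv_def)
  qed
  then show ?thesis
    using star_idealD(1)[OF assms] by (auto simp: socle_def lambda_eq_star subset_iff)
qed

section \<open>The torsion ideal and its primary parts\<close>

definition annihilated_by :: "(nat \<Rightarrow> bool) \<Rightarrow> 'a set" where
  "annihilated_by Q = {a \<in> carrier G. \<exists>n. Q n \<and> [n] \<cdot> a = \<zero>}"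

text \<open>If \<open>m\<close> kills \<open>a\<close> and \<open>n\<close> kills \<open>b\<close>,
  then \<open>m * n\<close> kills the sum, and what kills \<open>b\<close> kills
  \<open>a \<star> b\<close>. This treats the torsion subgroup, the 2-part and the odd part
  uniformly.\<close>

lemma annihilated_by_star_ideal:
  assumes "Q 1" and mult: "\<And>m n. Q m \<Longrightarrow> Q n \<Longrightarrow> Q (m * n)"
  shows "star_ideal (annihilated_by Q)"
  unfolding star_ideal_def
proof (intro conjI ballI)
  show "subgroup (annihilated_by Q) (add_monoid G)"
  proof (rule add.subgroupI)
    show "annihilated_by Q \<subseteq> carrier G" by (auto simp: annihilated_by_def)
    have "\<zero> \<in> annihilated_by Q" using assms(1) by (auto simp: annihilated_by_def)
    then show "annihilated_by Q \<noteq> {}" by auto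
    show "\<ominus> a \<in> annihilated_by Q" if "a \<in> annihilated_by Q" for a
      using that by (auto simp: annihilated_by_def add.nat_pow_inv)
    show "a \<oplus> b \<in> annihilated_by Q" if ab: "a \<in> annihilated_by Q" "b \<in> annihilated_by Q" for a b
    proof -
      from ab obtain m n where mn: "a \<in> carrier G" "b \<in> carrier G" "Q m" "Q n"
        "[m] \<cdot> a = \<zero>" "[n] \<cdot> b = \<zero>" by (auto simp: annihilated_by_def)
      have "[(m * n)] \<cdot> (a \<oplus> b) = [n] \<cdot> ([m] \<cdot> a) \<oplus> [m] \<cdot> ([n] \<cdot> b)"
        using mn(1,2) by (simp add: add.nat_pow_distrib add.nat_pow_pow mult.commute)
      with mn mult[of m n] show ?thesis by (auto simp: annihilated_by_def)
    qed
  qed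
  fix a b assume "a \<in> carrier G" "b \<in> annihilated_by Q"
  then show "a \<star> b \<in> annihilated_by Q"
    unfolding annihilated_by_def
    by clarsimp (metis star_add_pow_right star_zero_right)
qed

lemma torsion_eq: "torsion G = annihilated_by (\<lambda>n. 0 < n)"
  by (auto simp: torsion_def annihilated_by_def pow_eq_add_pow one_eq_zero)

abbreviation two_part :: "'a set" where
  "two_part \<equiv> annihilated_by (\<lambda>n. \<exists>k. n = 2 ^ k)"

abbreviation odd_part :: "'a set" where
  "odd_part \<equiv> annihilated_by odd"

lemma two_partI:
  assumes "a \<in> carrier G" "a \<oplus> a = \<zero>"
  shows "a \<in> two_part"
proof -
  have "[((2::nat) ^ 1)] \<cdot> a = \<zero>"
    using assms by (simp add: numeral_2_eq_2)
  then have "\<exists>n. (\<exists>k. n = (2::nat) ^ k) \<and> [n] \<cdot> a = \<zero>"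
    by blast
  with assms(1) show ?thesis
    by (simp add: annihilated_by_def)
qed

lemma star_ideals:
  "star_ideal (torsion G)" "star_ideal two_part" "star_ideal odd_part"
proof -
  have "\<exists>k. m * n = (2::nat) ^ k" if "\<exists>k. m = 2 ^ k" "\<exists>k. n = 2 ^ k" for m n
    using that by (metis power_add)
  then show "star_ideal two_part"
    by (intro annihilated_by_star_ideal) (auto intro: exI[of _ 0])
qed (auto simp: torsion_eq intro!: annihilated_by_star_ideal)

lemma annihilated_by_mono:
  "(\<And>n. P n \<Longrightarrow> Q n) \<Longrightarrow> annihilated_by P \<subseteq> annihilated_by Q"
  unfolding annihilated_by_def by blast

lemma parts_subset_torsion: "two_part \<subseteq> torsion G" "odd_part \<subseteq> torsion G"
  unfolding torsion_eq by (rule annihilated_by_mono; auto simp: odd_pos)+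

text \<open>Links orders computed in the torsion subgroup as a group of its own to additive
  annihilators in \<open>G\<close>.\<close>

lemma ord_torsion_dvd_iff:
  assumes "x \<in> torsion G"
  shows "group.ord (G\<lparr>carrier := torsion G\<rparr>) x dvd n \<longleftrightarrow> [n] \<cdot> x = \<zero>"
proof -
  interpret T: group "G\<lparr>carrier := torsion G\<rparr>"
    using star_ideal_subgroup[OF star_ideals(1)] by (rule subgroup_imp_group)
  have "x [^]\<^bsub>G\<lparr>carrier := torsion G\<rparr>\<^esub> n = [n] \<cdot> x"
    using assms by (simp flip: nat_pow_consistent add: pow_eq_add_pow torsion_def)
  then show ?thesis
    using T.pow_eq_id[of x n] assms by (simp add: one_eq_zero)
qed

lemma maximal_two_subgroup:
  "maximal_with (two_subgroup (G\<lparr>carrier := torsion G\<rparr>)) H \<longleftrightarrow> H = two_part"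
proof (rule maximal_with_greatest)
  have "\<exists>j. group.ord (G\<lparr>carrier := torsion G\<rparr>) x = 2 ^ j" if x: "x \<in> two_part" for x
  proof -
    obtain k where "[((2::nat) ^ k)] \<cdot> x = \<zero>"
      using x by (auto simp: annihilated_by_def)
    then have "group.ord (G\<lparr>carrier := torsion G\<rparr>) x dvd 2 ^ k"
      using x parts_subset_torsion by (simp add: ord_torsion_dvd_iff subset_iff)
    \<comment> \<open>A divisor of a power of two is again a power of two.\<close>
    then show ?thesis using divides_primepow_nat[OF two_is_prime_nat] by blast
  qed
  then show "two_subgroup (G\<lparr>carrier := torsion G\<rparr>) two_part"
    unfolding two_subgroup_def
    using subgroup_incl star_ideals[THEN star_ideal_subgroup] parts_subset_torsion by blast
  fix K assume K: "two_subgroup (G\<lparr>carrier := torsion G\<rparr>) K"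
  show "K \<subseteq> two_part"
  proof
    fix x assume x: "x \<in> K"
    then have t: "x \<in> torsion G" 
      using K x subgroup.subset[of K "G\<lparr>carrier := torsion G\<rparr>"] by (auto simp: two_subgroup_def)
    obtain k where "group.ord (G\<lparr>carrier := torsion G\<rparr>) x = 2 ^ k"
      using K x by (auto simp: two_subgroup_def)
    then have "[((2::nat) ^ k)] \<cdot> x = \<zero>" using ord_torsion_dvd_iff[OF t, of "2 ^ k"] by simp
    with t show "x \<in> two_part" by (auto simp: annihilated_by_def torsion_def)
  qed
qed

lemma maximal_odd_subgroup:
  "maximal_with (odd_subgroup (G\<lparr>carrier := torsion G\<rparr>)) H \<longleftrightarrow> H = odd_part"
proof (rule maximal_with_greatest)
  have "odd (group.ord (G\<lparr>carrier := torsion G\<rparr>) x)" if x: "x \<in> odd_part" for x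
  proof -
    obtain n :: nat where "odd n" "[n] \<cdot> x = \<zero>"
      using x by (auto simp: annihilated_by_def)
    moreover from this have "group.ord (G\<lparr>carrier := torsion G\<rparr>) x dvd n"
      using x parts_subset_torsion by (simp add: ord_torsion_dvd_iff subset_iff)
    ultimately show ?thesis using dvd_trans by blast
  qed
  then show "odd_subgroup (G\<lparr>carrier := torsion G\<rparr>) odd_part"
    unfolding odd_subgroup_def
    using subgroup_incl star_ideals[THEN star_ideal_subgroup] parts_subset_torsion by blast
  fix K assume K: "odd_subgroup (G\<lparr>carrier := torsion G\<rparr>) K"
  show "K \<subseteq> odd_part"
  proof
    fix x assume x: "x \<in> K"
    then have t: "x \<in> torsion G" 
      using K x subgroup.subset[of K "G\<lparr>carrier := torsion G\<rparr>"] by (auto simp: odd_subgroup_def)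
    moreover have "odd (group.ord (G\<lparr>carrier := torsion G\<rparr>) x)"
      using K x by (auto simp: odd_subgroup_def)
    \<comment> \<open>The order of \<open>x\<close> serves as the odd number that kills it.\<close>
    moreover have "[(group.ord (G\<lparr>carrier := torsion G\<rparr>) x)] \<cdot> x = \<zero>"
      by (rule iffD1[OF ord_torsion_dvd_iff[OF t] dvd_refl])
    ultimately show "x \<in> odd_part" by (auto simp: annihilated_by_def torsion_def)
  qed
qed

lemma coprime_annihilators:
  assumes "x \<in> carrier G" "[(m::nat)] \<cdot> x = \<zero>" "[(n::nat)] \<cdot> x = \<zero>" "coprime m n"
  shows "x = \<zero>"
proof -
  have "add.ord x dvd m" "add.ord x dvd n"
    using assms add.pow_eq_id[of x] by simp_all
  then have "add.ord x dvd 1"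
    using \<open>coprime m n\<close> coprime_common_divisor by blast
  then show ?thesis using assms(1) add.pow_eq_id[of x 1] by simp
qed

lemma two_part_Int_odd_part:
  assumes "x \<in> two_part" "x \<in> odd_part"
  shows "x = \<zero>"
proof -
  obtain k and n :: nat where "x \<in> carrier G" "[((2::nat) ^ k)] \<cdot> x = \<zero>" "odd n" "[n] \<cdot> x = \<zero>"
    using assms by (auto simp: annihilated_by_def)
  then show ?thesis
    by (intro coprime_annihilators[of x "2 ^ k" n]) (auto simp: coprime_commute)
qed

text \<open>Such products lie in both ideals, which meet only in zero.\<close>

lemma star_two_part_odd_part:
  assumes "e \<in> two_part" "d \<in> odd_part"
  shows "e \<star> d = \<zero>" "d \<star> e = \<zero>"
proof -
  note star_idealD[OF star_ideals(2)] star_idealD[OF star_ideals(3)]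
  then have "e \<star> d \<in> two_part" "e \<star> d \<in> odd_part" "d \<star> e \<in> two_part" "d \<star> e \<in> odd_part"
    using assms by (simp_all add: subset_iff)
  then show "e \<star> d = \<zero>" "d \<star> e = \<zero>"
    using two_part_Int_odd_part by blast+
qed

text \<open>Both components are integer multiples of \<open>t\<close>, so they annihilate whatever
  \<open>t\<close> annihilates. The last clause records this for the computation of the
  socle.\<close>

lemma torsion_decompose:
  assumes "t \<in> torsion G"
  shows "\<exists>e \<in> two_part. \<exists>d \<in> odd_part. t = e \<oplus> d
    \<and> (\<forall>b \<in> carrier G. t \<star> b = \<zero> \<longrightarrow> e \<star> b = \<zero> \<and> d \<star> b = \<zero>)"
proof -
  from assms obtain n :: nat where t: "t \<in> carrier G" and "0 < n" "[n] \<cdot> t = \<zero>"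
    by (auto simp: torsion_eq annihilated_by_def)
  define k where "k = multiplicity 2 n"
  obtain m where m: "n = 2 ^ k * m" "odd m"
    unfolding k_def by (rule multiplicity_decompose'[of n 2]) (use \<open>0 < n\<close> in auto)
  have mk: "[m] \<cdot> ([((2::nat) ^ k)] \<cdot> t) = \<zero>" "[((2::nat) ^ k)] \<cdot> ([m] \<cdot> t) = \<zero>"
    using t \<open>[n] \<cdot> t = \<zero>\<close> m by (simp_all add: add.nat_pow_pow mult.commute)
  have "gcd (2 ^ k) m = 1" using m by (simp flip: coprime_iff_gcd_eq_1)
  then obtain x y where xy: "2 ^ k * x = m * y + (1::nat)"
    using bezout_nat[of "2 ^ k" m] by auto
  \<comment> \<open>By Bezout, \<open>t\<close> is \<open>x * 2 ^ k\<close> times \<open>t\<close>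
    minus \<open>m * y\<close> times \<open>t\<close>. The first summand is killed by
    \<open>m\<close>, the second by \<open>2 ^ k\<close>.\<close>
  define d where "d = [x] \<cdot> ([((2::nat) ^ k)] \<cdot> t)"
  define e where "e = \<ominus> ([y] \<cdot> ([m] \<cdot> t))"
  have carr: "e \<in> carrier G" "d \<in> carrier G" using t by (simp_all add: e_def d_def)
  have "[((2::nat) ^ k)] \<cdot> ([y] \<cdot> ([m] \<cdot> t)) = [y] \<cdot> ([((2::nat) ^ k)] \<cdot> ([m] \<cdot> t))"
    using t add.nat_pow_pow[of "[m] \<cdot> t"] by (simp add: mult.commute)
  then have "[((2::nat) ^ k)] \<cdot> e = \<zero>"
    using t mk by (simp add: e_def add.nat_pow_inv)
  with carr have "e \<in> two_part" by (auto simp: annihilated_by_def)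
  moreover have "[m] \<cdot> d = [x] \<cdot> ([m] \<cdot> ([((2::nat) ^ k)] \<cdot> t))"
    unfolding d_def using t add.nat_pow_pow[of "[((2::nat) ^ k)] \<cdot> t"] by (simp add: mult.commute)
  with mk carr m have "d \<in> odd_part" by (auto simp: annihilated_by_def)
  moreover have "d = [y] \<cdot> ([m] \<cdot> t) \<oplus> t"
    using t xy by (simp add: d_def add.nat_pow_pow)
  then have "t = e \<oplus> d"
    using t by (simp add: e_def r_neg1)
  moreover have "e \<star> b = \<zero> \<and> d \<star> b = \<zero>" if "b \<in> carrier G" "t \<star> b = \<zero>" for b
    using that t by (simp add: e_def d_def star_minus_left star_add_pow_left)
  ultimately show ?thesis by blast
qed

text \<open>If \<open>d\<close> and \<open>b\<close> commute, then twice \<open>d \<star> b\<close>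
  is zero, so \<open>d \<star> b\<close> lies in the 2-part as well as in the odd part and vanishes.
  Hence center and socle agree on the odd part.\<close>

lemma center_odd_part:
  "center (G\<lparr>carrier := odd_part\<rparr>) = {d \<in> odd_part. \<forall>b \<in> odd_part. d \<star> b = \<zero>}"
proof -
  have "d \<otimes> b = b \<otimes> d \<longleftrightarrow> d \<star> b = \<zero>" if "d \<in> odd_part" "b \<in> odd_part" for d b
  proof -
    have carr: "d \<in> carrier G" "b \<in> carrier G" and "d \<star> b \<in> odd_part"
      using star_idealD[OF star_ideals(3)] that by (simp_all add: subset_iff)
    moreover have "d \<star> b \<in> two_part" if "d \<star> b \<oplus> d \<star> b = \<zero>"
      using carr that by (simp add: two_partI)
    ultimately show ?thesis
      using two_part_Int_odd_part[of "d \<star> b"] by (auto simp: commute_iff)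
  qed
  then show ?thesis by (auto simp: center_def)
qed

text \<open>Mixed products vanish, so annihilating the torsion ideal splits into annihilating the
  2-part and the odd part separately. For the same reason
  \<open>e \<otimes> d = e \<oplus> d\<close>.\<close>

lemma socle_torsion:
  "socle (G\<lparr>carrier := torsion G\<rparr>)
    = socle (G\<lparr>carrier := two_part\<rparr>) <#> center (G\<lparr>carrier := odd_part\<rparr>)"
proof (intro equalityI subsetI)
  note sub = star_ideals[THEN star_idealD(1)]
  fix t assume "t \<in> socle (G\<lparr>carrier := torsion G\<rparr>)"
  then have t: "t \<in> torsion G" "\<And>b. b \<in> torsion G \<Longrightarrow> t \<star> b = \<zero>"
    by (simp_all add: socle_star_ideal star_ideals)
  then obtain e d where ed: "e \<in> two_part" "d \<in> odd_part" "t = e \<oplus> d"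
    "\<And>b. b \<in> carrier G \<Longrightarrow> t \<star> b = \<zero> \<Longrightarrow> e \<star> b = \<zero> \<and> d \<star> b = \<zero>"
    using torsion_decompose by blast
  have carr: "e \<in> carrier G" "d \<in> carrier G" using ed sub by auto
  have zero: "e \<star> b = \<zero>" "d \<star> b = \<zero>" if "b \<in> torsion G" for b
    using ed(4) t(2) sub(1) that by blast+
  have "e \<in> socle (G\<lparr>carrier := two_part\<rparr>)" "d \<in> center (G\<lparr>carrier := odd_part\<rparr>)"
    using ed(1,2) zero parts_subset_torsion by (auto simp: socle_star_ideal star_ideals center_odd_part)
  moreover have "t = e \<otimes> d"
    using carr ed by (simp add: mult_eq_star star_two_part_odd_part)
  ultimately show "t \<in> socle (G\<lparr>carrier := two_part\<rparr>) <#> center (G\<lparr>carrier := odd_part\<rparr>)"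
    by (auto simp: set_mult_def)
next
  note sub = star_ideals[THEN star_idealD(1)]
  fix t assume "t \<in> socle (G\<lparr>carrier := two_part\<rparr>) <#> center (G\<lparr>carrier := odd_part\<rparr>)"
  then obtain e d where ed: "e \<in> two_part" "\<And>b. b \<in> two_part \<Longrightarrow> e \<star> b = \<zero>"
    "d \<in> odd_part" "\<And>b. b \<in> odd_part \<Longrightarrow> d \<star> b = \<zero>" "t = e \<otimes> d"
    by (auto simp: set_mult_def socle_star_ideal star_ideals center_odd_part)
  have carr: "e \<in> carrier G" "d \<in> carrier G" using ed sub by auto
  have t: "t = e \<oplus> d"
    using carr ed by (simp add: mult_eq_star star_two_part_odd_part)
  have "t \<star> b = \<zero>" if "b \<in> torsion G" for b
  proof -
    from that obtain e' d' where b: "e' \<in> two_part" "d' \<in> odd_part" "b = e' \<oplus> d'"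
      using torsion_decompose by blast
    then have "e' \<in> carrier G" "d' \<in> carrier G" using sub by auto
    with b ed(1-4) carr show ?thesis
      unfolding t by (simp add: star_add_left star_add_right star_two_part_odd_part)
  qed
  moreover have "t \<in> torsion G"
    using ed(1,3) t star_idealD(3)[OF star_ideals(1)] parts_subset_torsion by auto
  ultimately show "t \<in> socle (G\<lparr>carrier := torsion G\<rparr>)"
    by (simp add: socle_star_ideal star_ideals)
qed

section \<open>The associated solution in closed form, and quotients of set-theoretic maps\<close>

definition yb_map :: "'a \<times> 'a \<Rightarrow> 'a \<times> 'a" where
  "yb_map = (\<lambda>(x, y). (y \<oplus> x \<star> y, x \<oplus> x \<star> y))"

lemma yb_map_simp [simp]: "yb_map (x, y) = (y \<oplus> x \<star> y, x \<oplus> x \<star> y)"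
  by (simp add: yb_map_def)

lemma star_left_self:
  assumes "a \<in> carrier G" "b \<in> carrier G"
  shows "a \<star> (a \<star> b) = \<zero>"
  using assms by (simp flip: star_assoc)

lemma star_left_swap:
  assumes "a \<in> carrier G" "b \<in> carrier G" "c \<in> carrier G"
  shows "a \<star> (b \<star> c) = \<ominus> (b \<star> (a \<star> c))"
  using assms star_anticommute[of a b] by (simp add: star_minus_left flip: star_assoc)

text \<open>Left multiplication by \<open>u\<close> squares to zero, so \<open>1 + u\<close> and
  \<open>1 - u\<close> act as mutually inverse maps.\<close>

lemma star_shift_inverse:
  assumes "u \<in> carrier G" "b \<in> carrier G"
  shows "(b \<oplus> u \<star> b) \<oplus> (\<ominus> u) \<star> (b \<oplus> u \<star> b) = b"
    "(b \<oplus> (\<ominus> u) \<star> b) \<oplus> u \<star> (b \<oplus> (\<ominus> u) \<star> b) = b"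
  using assms
  by (simp_all add: star_minus_left star_add_right star_minus_right star_left_self a_assoc r_neg l_neg)

lemma star_shift_bij:
  assumes "u \<in> carrier G"
  shows "bij_betw (\<lambda>b. b \<oplus> u \<star> b) (carrier G) (carrier G)"
  by (rule bij_betw_byWitness[where f' = "\<lambda>b. b \<oplus> (\<ominus> u) \<star> b"])
    (use assms star_shift_inverse in auto)

lemma yb_map_involutive:
  assumes "x \<in> carrier G" "y \<in> carrier G"
  shows "yb_map (yb_map (x, y)) = (x, y)"
proof -
  \<comment> \<open>Every term of length three or more has a repeated factor and vanishes, leaving
    only \<open>y \<star> x\<close>.\<close>
  have "(y \<oplus> x \<star> y) \<star> (x \<oplus> x \<star> y) = \<ominus> (x \<star> y)"
    using assms star_anticommute[of y x]
    by (simp add: star_add_left star_add_right star_assoc star_minus_right star_left_self star_sandwich)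
  then show ?thesis using assms by (simp add: a_assoc r_neg)
qed

text \<open>Removes \<open>inv_into\<close> from the solution. The two maps are compared on the
  carrier only, where alone the values matter.\<close>

lemma brace_solution_eq:
  "fst (brace_solution G) = carrier G"
  "\<lbrakk>x \<in> carrier G; y \<in> carrier G\<rbrakk> \<Longrightarrow> snd (brace_solution G) (x, y) = yb_map (x, y)"
proof -
  show "fst (brace_solution G) = carrier G" by (simp add: brace_solution_def)
  assume xy: "x \<in> carrier G" "y \<in> carrier G"
  define u where "u = y \<oplus> x \<star> y"
  have u: "u \<in> carrier G" using xy by (simp add: u_def)
  have "inj_on (brace_lambda G u) (carrier G)"
    using bij_betw_imp_inj_on[OF star_shift_bij[OF u]]
    by (rule inj_on_cong[THEN iffD1, rotated]) (simp add: lambda_eq_star u)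
  \<comment> \<open>Involutivity exhibits the preimage of \<open>x\<close>; injectivity makes it the
    one that \<open>inv_into\<close> selects.\<close>
  moreover have "brace_lambda G u (x \<oplus> x \<star> y) = x"
    using yb_map_involutive[OF xy] xy u by (simp add: lambda_eq_star u_def)
  ultimately have "inv_into (carrier G) (brace_lambda G u) x = x \<oplus> x \<star> y"
    using xy by (intro inv_into_f_eq) simp_all
  then show "snd (brace_solution G) (x, y) = yb_map (x, y)"
    using xy by (simp add: brace_solution_def lambda_eq_star u_def)
qed

lemma yb_map_braid:
  assumes "x \<in> carrier G" "y \<in> carrier G" "z \<in> carrier G"
  shows "ybe_r1 yb_map (ybe_r2 yb_map (ybe_r1 yb_map (x, y, z)))
    = ybe_r2 yb_map (ybe_r1 yb_map (ybe_r2 yb_map (x, y, z)))"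
proof -
  \<comment> \<open>\<open>u\<close> and \<open>v\<close> evaluate the star products in the second
    and third application on the left side, \<open>w\<close> and \<open>t\<close> those on the
    right. In \<open>v\<close> and \<open>t\<close> repeated factors vanish and the two remaining
    triple products cancel.\<close>
  have u: "(x \<oplus> x \<star> y) \<star> z = x \<star> z \<oplus> x \<star> (y \<star> z)"
    using assms by (simp add: star_add_left star_assoc)
  have v: "(y \<oplus> x \<star> y) \<star> (z \<oplus> (x \<star> z \<oplus> x \<star> (y \<star> z))) = y \<star> z"
    using assms
    by (simp add: star_add_left star_add_right star_assoc star_left_swap[of y x] star_left_self
        star_minus_right r_neg l_neg a_assoc)
  have w: "x \<star> (z \<oplus> y \<star> z) = x \<star> z \<oplus> x \<star> (y \<star> z)"
    using assms by (simp add: star_add_right)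
  have t: "(x \<oplus> (x \<star> z \<oplus> x \<star> (y \<star> z))) \<star> (y \<oplus> y \<star> z) = x \<star> y"
    using assms
    by (simp add: star_add_left star_add_right star_assoc star_sandwich star_left_self star_anticommute[of z y]
        star_minus_right r_neg l_neg a_assoc)
  show ?thesis
    using assms by (simp add: ybe_r1_def ybe_r2_def u v w t a_ac)
qed

lemma ybe_solution: "ybe_solution (brace_solution G)"
proof -
  define r where "r = snd (brace_solution G)"
  have r: "r (x, y) = (y \<oplus> x \<star> y, x \<oplus> x \<star> y)" if "x \<in> carrier G" "y \<in> carrier G" for x y
    using that brace_solution_eq(2) by (simp add: r_def)
  have "bij_betw (ybe_sigma r x) (carrier G) (carrier G)" if "x \<in> carrier G" for x
    using star_shift_bij[OF that] by (rule bij_betw_cong[THEN iffD1, rotated]) (simp add: ybe_sigma_def r that)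
  \<comment> \<open>By \<open>star_swap\<close>,
    \<open>x \<star> y = (\<ominus> y) \<star> x\<close>, so this map is the shift by
    \<open>\<ominus> y\<close>.\<close>
  moreover have "bij_betw (ybe_gamma r y) (carrier G) (carrier G)" if "y \<in> carrier G" for y
    using star_shift_bij[OF a_inv_closed[OF that]]
    by (rule bij_betw_cong[THEN iffD1, rotated]) (simp add: ybe_gamma_def r that star_swap)
  moreover have "ybe_r1 r (ybe_r2 r (ybe_r1 r (x, y, z))) = ybe_r2 r (ybe_r1 r (ybe_r2 r (x, y, z)))"
    if "x \<in> carrier G" "y \<in> carrier G" "z \<in> carrier G" for x y z
    using yb_map_braid[OF that] that by (simp add: ybe_r1_def ybe_r2_def r)
  moreover have "r (r (x, y)) = (x, y)" if "x \<in> carrier G" "y \<in> carrier G" for x y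
    using yb_map_involutive[OF that] that by (simp add: r)
  ultimately have "ybe_solution (carrier G, r)"
    by (auto simp: ybe_solution_def r)
  moreover have "(carrier G, r) = brace_solution G"
    by (simp add: r_def brace_solution_def)
  ultimately show ?thesis by simp
qed

end

text \<open>Presents a set-theoretic map as the quotient, along \<open>\<rho>\<close>, of a fixed map \<open>s\<close> on \<open>A\<close>; every
  iterated retraction is described on the original carrier this way.\<close>

definition quotient_of :: "'a set \<Rightarrow> ('a \<times> 'a \<Rightarrow> 'a \<times> 'a) \<Rightarrow> ('a \<Rightarrow> 'b) \<Rightarrow> 'b set_map \<Rightarrow> bool" where
  "quotient_of A s \<rho> S \<longleftrightarrow> fst S = \<rho> ` A \<and>
     (\<forall>x \<in> A. \<forall>y \<in> A. snd S (\<rho> x, \<rho> y) = map_prod \<rho> \<rho> (s (x, y)))"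

text \<open>One retraction step, described on \<open>A\<close>: \<open>E\<close> is the retraction
  relation pulled back along \<open>\<rho>\<close>, and \<open>cong\<close> makes the induced map
  independent of representatives. The new projection sends a point to the chosen representative of
  its class.\<close>

lemma quotient_of_retraction:
  assumes S: "quotient_of A s \<rho> S"
    and s: "\<And>x y. \<lbrakk>x \<in> A; y \<in> A\<rbrakk> \<Longrightarrow> s (x, y) \<in> A \<times> A"
    and E: "\<And>x y. \<lbrakk>x \<in> A; y \<in> A\<rbrakk> \<Longrightarrow>
      E x y \<longleftrightarrow> (\<forall>z \<in> A. \<rho> (fst (s (x, z))) = \<rho> (fst (s (y, z))))"
    and cong: "\<And>x x' y y'. \<lbrakk>x \<in> A; x' \<in> A; y \<in> A; y' \<in> A; E x x'; E y y'\<rbrakk> \<Longrightarrow>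
      E (fst (s (x, y))) (fst (s (x', y'))) \<and> E (snd (s (x, y))) (snd (s (x', y')))"
  shows "\<exists>\<rho>'. quotient_of A s \<rho>' (relabel class_rep (retraction S)) \<and>
    (\<forall>x \<in> A. \<forall>y \<in> A. \<rho>' x = \<rho>' y \<longleftrightarrow> E x y)"
proof -
  obtain X r where Xr: "S = (X, r)" by force
  have X: "X = \<rho> ` A" and r: "\<And>x y. \<lbrakk>x \<in> A; y \<in> A\<rbrakk> \<Longrightarrow> r (\<rho> x, \<rho> y) = map_prod \<rho> \<rho> (s (x, y))"
    using S by (auto simp: quotient_of_def Xr)
  let ?R = "ret_rel (X, r)"
  define cls where "cls x = ?R `` {\<rho> x}" for x
  have R: "(\<rho> x, \<rho> y) \<in> ?R \<longleftrightarrow> E x y" if "x \<in> A" "y \<in> A" for x y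
    using that by (auto simp: ret_rel_def X ybe_sigma_def r E)
  have cls_eq: "cls x = cls y \<longleftrightarrow> E x y" if "x \<in> A" "y \<in> A" for x y
    unfolding cls_def using that R eq_equiv_class_iff[OF equiv_ret_rel, of "\<rho> x" X "\<rho> y" r]
    by (auto simp: X)
  have quot: "X // ?R = cls ` A"
    by (auto simp: quotient_def X cls_def)
  have mem: "a \<in> cls x \<longleftrightarrow> (\<exists>x' \<in> A. a = \<rho> x' \<and> E x x')" if "x \<in> A" for a x
  proof -
    have "a \<in> cls x \<longleftrightarrow> a \<in> \<rho> ` A \<and> (\<rho> x, a) \<in> ?R"
      by (auto simp: cls_def ret_rel_def X)
    then show ?thesis using R that by auto
  qed
  have refl: "E x x" if "x \<in> A" for x using cls_eq that by blast
  have ret: "snd (retraction (X, r)) (cls x, cls y) = map_prod cls cls (s (x, y))"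
    if xy: "x \<in> A" "y \<in> A" for x y
  proof -
    have s': "fst (s (x', y')) \<in> A" "snd (s (x', y')) \<in> A" if "x' \<in> A" "y' \<in> A" for x' y'
      using s[OF that] by (auto simp: mem_Times_iff)
    have "?R `` {ybe_sigma r a b} = cls (fst (s (x, y)))"
      "?R `` {ybe_gamma r b a} = cls (snd (s (x, y)))"
      if ab: "a \<in> cls x" "b \<in> cls y" for a b
    proof -
      obtain x' y' where *: "x' \<in> A" "y' \<in> A" "a = \<rho> x'" "b = \<rho> y'" "E x x'" "E y y'"
        using ab mem xy by blast
      then have "cls (fst (s (x, y))) = cls (fst (s (x', y')))"
        "cls (snd (s (x, y))) = cls (snd (s (x', y')))"
        using cong[of x x' y y'] xy s' by (simp_all add: cls_eq)
      then show "?R `` {ybe_sigma r a b} = cls (fst (s (x, y)))"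
        "?R `` {ybe_gamma r b a} = cls (snd (s (x, y)))"
        using * by (simp_all add: ybe_sigma_def ybe_gamma_def r cls_def)
    qed
    moreover have "\<rho> x \<in> cls x" "\<rho> y \<in> cls y" using mem refl xy by blast+
    \<comment> \<open>Unions of a constant family over non-empty index sets.\<close>
    ultimately have "(\<Union>a \<in> cls x. \<Union>b \<in> cls y. ?R `` {ybe_sigma r a b}) = cls (fst (s (x, y)))"
      "(\<Union>a \<in> cls x. \<Union>b \<in> cls y. ?R `` {ybe_gamma r b a}) = cls (snd (s (x, y)))"
      by fastforce+
    then show ?thesis by (simp add: retraction_def map_prod_def split_beta)
  qed
  \<comment> \<open>Injectivity lets \<open>inv_into\<close> in \<open>relabel\<close> recover the
    class from its representative.\<close>
  have inj: "inj_on class_rep (cls ` A)"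
    using class_rep_inj_on[of X r] quot by (simp add: retraction_def)
  have fst_ret: "fst (retraction (X, r)) = cls ` A"
    using quot by (simp add: retraction_def)
  have "quotient_of A s (class_rep \<circ> cls) (relabel class_rep (retraction S))"
    unfolding quotient_of_def
  proof (intro conjI ballI)
    show "fst (relabel class_rep (retraction S)) = (class_rep \<circ> cls) ` A"
      using fst_ret by (simp add: Xr relabel_def split_beta image_comp)
    fix x y assume xy: "x \<in> A" "y \<in> A"
    then show "snd (relabel class_rep (retraction S)) ((class_rep \<circ> cls) x, (class_rep \<circ> cls) y)
      = map_prod (class_rep \<circ> cls) (class_rep \<circ> cls) (s (x, y))"
      using inj by (simp add: Xr relabel_def split_beta fst_ret ret inv_into_f_f prod.map_comp)
  qed
  moreover have "(class_rep \<circ> cls) x = (class_rep \<circ> cls) y \<longleftrightarrow> E x y" if "x \<in> A" "y \<in> A" for x y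
    using that inj cls_eq by (simp add: inj_on_eq_iff)
  ultimately show ?thesis by blast
qed

section \<open>The socle series and iterated retractions\<close>

context square_free_brace
begin

text \<open>An analogue of the upper central series: each term is the preimage of the socle of the
  quotient by the previous term.\<close>

primrec socle_series :: "nat \<Rightarrow> 'a set" where
  "socle_series 0 = {\<zero>}"
| "socle_series (Suc k) = {a \<in> carrier G. \<forall>z \<in> carrier G. a \<star> z \<in> socle_series k}"

lemma socle_series_star_ideal: "star_ideal (socle_series k)"
proof (induction k)
  case 0
  then show ?case
    unfolding star_ideal_def by (auto intro!: add.subgroupI)
next
  case (Suc k)
  note I = star_idealD[OF Suc.IH]
  show ?case
    unfolding star_ideal_def
  proof (intro conjI ballI add.subgroupI)
    show "socle_series (Suc k) \<noteq> {}"
      using I(2) by (auto intro!: exI[of _ \<zero>])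
  qed (use I in \<open>auto simp: star_minus_left star_add_left star_assoc\<close>)
qed

lemma socle_series_swap:
  assumes "a \<in> carrier G" "b \<in> carrier G"
  shows "a \<star> b \<in> socle_series k \<longleftrightarrow> b \<star> a \<in> socle_series k"
  using assms star_idealD(4)[OF socle_series_star_ideal] star_anticommute by metis

text \<open>Modulo the \<open>k\<close>-th term, the maps \<open>\<sigma>\<close> of
  \<open>x\<close> and \<open>y\<close> agree iff \<open>(x \<ominus> y) \<star> z\<close> lies in
  that term for all \<open>z\<close>. This says exactly that \<open>x \<ominus> y\<close> lies in
  the next term.\<close>

lemma iterated_retraction_quotient:
  "\<exists>\<rho>. quotient_of (carrier G) yb_map \<rho> (iterated_retraction k (brace_solution G)) \<and>
    (\<forall>x \<in> carrier G. \<forall>y \<in> carrier G. \<rho> x = \<rho> y \<longleftrightarrow> x \<ominus> y \<in> socle_series k)"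
proof (induction k)
  case 0
  have "quotient_of (carrier G) yb_map id (iterated_retraction 0 (brace_solution G))"
    by (simp add: quotient_of_def iterated_retraction_def brace_solution_eq)
  moreover have "id x = id y \<longleftrightarrow> x \<ominus> y \<in> socle_series 0"
    if "x \<in> carrier G" "y \<in> carrier G" for x y
    using that a_cancel[of "\<ominus> y" x y] by (simp add: minus_eq l_neg a_comm[of x])
  ultimately show ?case by blast
next
  case (Suc k)
  then obtain \<rho> where \<rho>: "quotient_of (carrier G) yb_map \<rho> (iterated_retraction k (brace_solution G))"
    "\<And>x y. \<lbrakk>x \<in> carrier G; y \<in> carrier G\<rbrakk> \<Longrightarrow> \<rho> x = \<rho> y \<longleftrightarrow> x \<ominus> y \<in> socle_series k"
    by blast
  note I = star_idealD[OF socle_series_star_ideal[of "Suc k"]]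
  have step: "iterated_retraction (Suc k) (brace_solution G)
      = relabel class_rep (retraction (iterated_retraction k (brace_solution G)))"
    by (simp add: iterated_retraction_def)
  show ?case
    unfolding step
  proof (rule quotient_of_retraction[OF \<rho>(1)])
    fix x y assume xy: "x \<in> carrier G" "y \<in> carrier G"
    then show "yb_map (x, y) \<in> carrier G \<times> carrier G" by simp
    have "(z \<oplus> x \<star> z) \<ominus> (z \<oplus> y \<star> z) = (x \<ominus> y) \<star> z" if "z \<in> carrier G" for z
      using xy that by algebra
    with xy show "x \<ominus> y \<in> socle_series (Suc k) \<longleftrightarrow>
        (\<forall>z \<in> carrier G. \<rho> (fst (yb_map (x, z))) = \<rho> (fst (yb_map (y, z))))"
      by (simp add: \<rho>(2))
  next
    fix x x' y y'
    assume xy: "x \<in> carrier G" "x' \<in> carrier G" "y \<in> carrier G" "y' \<in> carrier G"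
      and I_xy: "x \<ominus> x' \<in> socle_series (Suc k)" "y \<ominus> y' \<in> socle_series (Suc k)"
    \<comment> \<open>This element is \<open>x \<star> y \<ominus> x' \<star> y'\<close>, the part
      common to both coordinate differences.\<close>
    have "(x \<ominus> x') \<star> y \<oplus> x' \<star> (y \<ominus> y') \<in> socle_series (Suc k)"
      by (rule I(3)[OF I(6)[OF I_xy(1) xy(3)] I(5)[OF xy(2) I_xy(2)]])
    from I(3)[OF I_xy(2) this] I(3)[OF I_xy(1) this] have "(y \<ominus> y') \<oplus> ((x \<ominus> x') \<star> y \<oplus> x' \<star> (y \<ominus> y')) \<in> socle_series (Suc k)"
      "(x \<ominus> x') \<oplus> ((x \<ominus> x') \<star> y \<oplus> x' \<star> (y \<ominus> y')) \<in> socle_series (Suc k)"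
      .
    moreover have "(y \<oplus> x \<star> y) \<ominus> (y' \<oplus> x' \<star> y') = (y \<ominus> y') \<oplus> ((x \<ominus> x') \<star> y \<oplus> x' \<star> (y \<ominus> y'))"
      "(x \<oplus> x \<star> y) \<ominus> (x' \<oplus> x' \<star> y') = (x \<ominus> x') \<oplus> ((x \<ominus> x') \<star> y \<oplus> x' \<star> (y \<ominus> y'))"
      using xy by algebra+
    ultimately show "fst (yb_map (x, y)) \<ominus> fst (yb_map (x', y')) \<in> socle_series (Suc k) \<and>
        snd (yb_map (x, y)) \<ominus> snd (yb_map (x', y')) \<in> socle_series (Suc k)"
      by simp
  qed
qed

section \<open>Vanishing of long star products\<close>

lemma foldr_star_closed:
  "\<lbrakk>set xs \<subseteq> carrier G; a \<in> carrier G\<rbrakk> \<Longrightarrow> foldr (\<star>) xs a \<in> carrier G"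
  by (induction xs) auto

text \<open>Anticommutativity moves \<open>x\<close> inward, up to sign, until it meets its copy in
  the list.\<close>

lemma star_foldr_zero:
  assumes "x \<in> set xs" "set xs \<subseteq> carrier G" "a \<in> carrier G"
  shows "x \<star> foldr (\<star>) xs a = \<zero>"
  using assms
proof (induction xs)
  case (Cons y xs)
  have f: "foldr (\<star>) xs a \<in> carrier G" using Cons.prems foldr_star_closed by simp
  show ?case
  proof (cases "x = y")
    case True
    then show ?thesis using f Cons.prems by (simp add: star_left_self)
  next
    case False
    with Cons have "x \<star> foldr (\<star>) xs a = \<zero>" by simp
    moreover have "x \<in> carrier G" "y \<in> carrier G" using Cons.prems by auto
    ultimately show ?thesis using f star_left_swap[of x y] by simp
  qed
qed simp

lemma foldr_star_repeated:
  assumes "\<not> distinct xs" "set xs \<subseteq> carrier G" "a \<in> carrier G"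
  shows "foldr (\<star>) xs a = \<zero>"
  using assms by (induction xs) (auto simp: star_foldr_zero)

text \<open>The lists multiply from the left, the series from the right;
  \<open>socle_series_swap\<close> reconciles the two.\<close>

lemma mem_socle_series:
  assumes "a \<in> carrier G"
    and "\<And>xs. \<lbrakk>length xs = k; set xs \<subseteq> carrier G\<rbrakk> \<Longrightarrow> foldr (\<star>) xs a = \<zero>"
  shows "a \<in> socle_series k"
  using assms
proof (induction k arbitrary: a)
  case 0
  then show ?case using "0.prems"(2)[of "[]"] by simp
next
  case (Suc k)
  have "z \<star> a \<in> socle_series k" if z: "z \<in> carrier G" for z
  proof (rule Suc.IH)
    show "z \<star> a \<in> carrier G" using z Suc.prems by simp
    show "foldr (\<star>) xs (z \<star> a) = \<zero>" if "length xs = k" "set xs \<subseteq> carrier G" for xs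
      \<comment> \<open>The new factor acts first and therefore stands last in the list.\<close>
      using Suc.prems(2)[of "xs @ [z]"] z that by simp
  qed
  then show ?case using Suc.prems(1) by (simp add: socle_series_swap[of a])
qed

text \<open>A triple product is killed by 2, so a product of \<open>3n\<close> factors is one of \<open>n\<close> factors in the
  2-part; beyond the order of the 2-part some factor repeats, and the product vanishes.\<close>

lemma foldr_star_triples:
  assumes "length xs = 3 * n" "set xs \<subseteq> carrier G" "a \<in> carrier G"
  shows "\<exists>ys. length ys = n \<and> set ys \<subseteq> two_part \<and> foldr (\<star>) xs a = foldr (\<star>) ys a"
  using assms
proof (induction n arbitrary: xs)
  case 0
  then show ?case by (intro exI[of _ "[]"]) simp
next
  case (Suc n)
  from Suc.prems(1) obtain x y z zs where xs: "xs = x # y # z # zs" "length zs = 3 * n"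
    by (auto simp: numeral_3_eq_3 length_Suc_conv)
  then obtain ys where ys: "length ys = n" "set ys \<subseteq> two_part" "foldr (\<star>) zs a = foldr (\<star>) ys a"
    using Suc.IH[of zs] Suc.prems by auto
  have carr: "x \<in> carrier G" "y \<in> carrier G" "z \<in> carrier G" "foldr (\<star>) zs a \<in> carrier G"
    using Suc.prems xs foldr_star_closed by auto
  then have "x \<star> y \<star> z \<in> two_part"
    by (intro two_partI triple_two_torsion) simp_all
  moreover have "foldr (\<star>) xs a = x \<star> y \<star> z \<star> foldr (\<star>) ys a"
    using carr by (simp add: xs star_assoc flip: ys(3))
  ultimately show ?case
    using ys by (intro exI[of _ "x \<star> y \<star> z # ys"]) simp
qed

lemma socle_series_eq_carrier:
  assumes "finite two_part"
  shows "socle_series (3 * Suc (card two_part)) = carrier G"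
proof
  show "carrier G \<subseteq> socle_series (3 * Suc (card two_part))"
  proof
    fix a assume a: "a \<in> carrier G"
    show "a \<in> socle_series (3 * Suc (card two_part))"
    proof (rule mem_socle_series[OF a])
      fix xs :: "'a list"
      assume "length xs = 3 * Suc (card two_part)" "set xs \<subseteq> carrier G"
      then obtain ys where ys: "length ys = Suc (card two_part)" "set ys \<subseteq> two_part"
        "foldr (\<star>) xs a = foldr (\<star>) ys a"
        using foldr_star_triples a by blast
      \<comment> \<open>Pigeonhole: \<open>ys\<close> has one entry more than the 2-part has
        elements.\<close>
      have "\<not> distinct ys"
        using card_mono[OF assms ys(2)] ys(1) distinct_card by fastforce
      then show "foldr (\<star>) xs a = \<zero>"
        using ys star_idealD(1)[OF star_ideals(2)] a by (simp add: foldr_star_repeated)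
    qed
  qed
qed (rule star_idealD(1)[OF socle_series_star_ideal])

text \<open>Once the series has reached the carrier, every point is identified with
  \<open>\<zero>\<close>, and a single point remains.\<close>

lemma multipermutation:
  assumes "finite two_part"
  shows "multipermutation_solution (brace_solution G)"
proof -
  let ?m = "3 * Suc (card two_part)"
  obtain \<rho> where \<rho>: "quotient_of (carrier G) yb_map \<rho> (iterated_retraction ?m (brace_solution G))"
    "\<And>x y. \<lbrakk>x \<in> carrier G; y \<in> carrier G\<rbrakk> \<Longrightarrow> \<rho> x = \<rho> y \<longleftrightarrow> x \<ominus> y \<in> socle_series ?m"
    using iterated_retraction_quotient by blast
  have "\<rho> x = \<rho> \<zero>" if "x \<in> carrier G" for x
    using that \<rho>(2)[of x \<zero>] by (simp only: socle_series_eq_carrier[OF assms] zero_closed minus_closed)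
  then have "\<rho> ` carrier G = {\<rho> \<zero>}" using zero_closed by blast
  then have "card (fst (iterated_retraction ?m (brace_solution G))) = 1"
    using \<rho>(1) by (simp add: quotient_of_def)
  then show ?thesis
    unfolding multipermutation_solution_def using ybe_solution by blast
qed

end

theorem theorem7p4:
  fixes G :: "('a, 'm) ring_scheme"
  assumes "left_brace G"
    and "\<And>a. a \<in> carrier G \<Longrightarrow> brace_lambda G a a = a"
  shows "two_sided_brace G
    \<and> nilpotent_group G \<and> nilpotency_class G \<le> 2
    \<and> socle G \<subseteq> center G
    \<and> brace_ideal (torsion G) G
    \<and> (\<exists>!Ge. maximal_with (two_subgroup (G\<lparr>carrier := torsion G\<rparr>)) Ge)
    \<and> (\<exists>!Go. maximal_with (odd_subgroup (G\<lparr>carrier := torsion G\<rparr>)) Go)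
    \<and> (\<forall>Ge Go. maximal_with (two_subgroup (G\<lparr>carrier := torsion G\<rparr>)) Ge
          \<and> maximal_with (odd_subgroup (G\<lparr>carrier := torsion G\<rparr>)) Go \<longrightarrow>
        brace_ideal Ge G \<and> brace_ideal Go G
        \<and> socle (G\<lparr>carrier := torsion G\<rparr>) = socle (G\<lparr>carrier := Ge\<rparr>) <#>\<^bsub>G\<^esub> center (G\<lparr>carrier := Go\<rparr>)
        \<and> (finite Ge \<and> finitely_generated_group (brace_quotient G (torsion G)) \<longrightarrow>
             multipermutation_solution (brace_solution G)))"
proof -
  interpret square_free_brace G
    by (rule square_free_brace.intro[OF assms(1)]) (unfold_locales, rule assms(2))
  \<comment> \<open>With maximality rewritten as equality, the claims on \<open>Ge\<close> and
    \<open>Go\<close> become claims on \<open>two_part\<close> and \<open>odd_part\<close>.\<close>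
  have parts: "maximal_with (two_subgroup (G\<lparr>carrier := torsion G\<rparr>)) = (\<lambda>H. H = two_part)"
    "maximal_with (odd_subgroup (G\<lparr>carrier := torsion G\<rparr>)) = (\<lambda>H. H = odd_part)"
    using maximal_two_subgroup maximal_odd_subgroup by blast+
  show ?thesis
    unfolding parts
  proof (intro conjI allI impI; (elim conjE)?)
    show "two_sided_brace G" by (rule two_sided)
    show "nilpotent_group G" "nilpotency_class G \<le> 2" by (rule nilpotent)+
    show "socle G \<subseteq> center G" by (rule socle_subset_center)
    show "brace_ideal (torsion G) G" by (rule star_ideal_brace_ideal[OF star_ideals(1)])
    show "\<exists>!Ge. Ge = two_part" "\<exists>!Go. Go = odd_part" by blast+
    fix Ge Go assume Ge: "Ge = two_part" and Go: "Go = odd_part"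
    show "brace_ideal Ge G" "brace_ideal Go G"
      unfolding Ge Go by (rule star_ideals[THEN star_ideal_brace_ideal])+
    show "socle (G\<lparr>carrier := torsion G\<rparr>)
        = socle (G\<lparr>carrier := Ge\<rparr>) <#>\<^bsub>G\<^esub> center (G\<lparr>carrier := Go\<rparr>)"
      unfolding Ge Go by (rule socle_torsion)
    assume "finite Ge"
    then show "multipermutation_solution (brace_solution G)"
      unfolding Ge by (rule multipermutation)
  qed
qed

end
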